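(* Let $0<k<m$ be integers and let $\mathcal T_h$ be a given mesh composed of $N$ simplexes $K_1,\dots,K_N$ with diameters $h_1,\dots,h_N>0$. Let $N=N_1+N_2$, where $N_1$ is the number of simplexes with $h_\mu\le h^*$ and $N_2$ the number with $h_\mu>h^*$, the simplexes being indexed so that $h_\mu\le h^*$ for $1\le\mu\le N_1$ and $h_\mu>h^*$ for $N_1+1\le\mu\le N$. Let $S_N=\sum_{\mu=1}^NY_\mu$, where $Y_1,\dots,Y_N$ are independent and $Y_\mu$ is the indicator of the event "$P_m$ is locally more accurate than $P_k$ on $K_\mu$", i.e. of $\{X_{K_\mu}^{(m)}(h_\mu)\le X_{K_\mu}^{(k)}(h_\mu)\}$. Then $$\mathrm{Prob}\{S_N\ge1\}=1-\frac1{2^{N_1}}\left[\frac{h_1\cdots h_{N_1}}{(h^* )^{N_1}}\right]^{m-k}\ \prod_{\mu=N_1+1}^{N}\left[1-\frac12\left(\frac{h^*}{h_\mu}\right)^{m-k}\right],$$ with empty products equal to $1$.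
   Context: $u\in H^{m+1}(\Omega)$ is the exact solution of an elliptic variational problem on a bounded open set $\Omega$, and $\mathcal T_h$ is a regular simplicial mesh of $\Omega$. For a simplex $K$ of diameter $h_K$ and $i\in\{k,m\}$, $\Pi_K^{(i)}$ is the local Lagrange interpolation operator of degree $i$ on $K$, and $X_K^{(i)}(h_K):=\|u-\Pi_K^{(i)}u\|_{1,K}$ is the local interpolation error in the $H^1(K)$ norm, which satisfies $X_K^{(i)}(h_K)\le C_i'h_K^i$ with a constant $C_i'>0$ independent of $K$ and $h_K$. Probabilistic model: these errors are treated as random variables; for each simplex $K$, $X_K^{(k)}(h_K)$ and $X_K^{(m)}(h_K)$ are assumed independent, with $X_K^{(i)}(h_K)$ uniformly distributed on $[0,C_i'h_K^i]$ for $i\in\{k,m\}$. Set $h^*:=(C_k'/C_m')^{1/(m-k)}$. Under these assumptions $\mathrm{Prob}\{X_K^{(m)}(h_K)\le X_K^{(k)}(h_K)\}$ equals $1-\frac12(h_K/h^* )^{m-k}$ if $0<h_K\le h^*$ and $\frac12(h^*/h_K)^{m-k}$ if $h_K\ge h^*$. $Y_\mu=1$ if $X_{K_\mu}^{(m)}(h_\mu)\le X_{K_\mu}^{(k)}(h_\mu)$ and $Y_\mu=0$ otherwise; the Bernoulli variables $Y_\mu$ are assumed to be independent. *)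

theory Defs
  imports "HOL-Probability.Probability"
begin

text \<open>Conforming mesh of \<Omega> by full-dimensional simplexes: any two of them meet in a common
  (possibly empty) face, and together they fill the closure of \<Omega>.  Shape regularity is a uniform
  bound over a family of meshes and says nothing about a single finite one, so it does not appear.\<close>

definition simplicial_mesh :: "'a::euclidean_space set \<Rightarrow> 'a set set \<Rightarrow> bool" where
  "simplicial_mesh \<Omega> T \<longleftrightarrow>
     triangulation T \<and> (\<forall>K\<in>T. int DIM('a) simplex K) \<and> \<Union>T = closure \<Omega>"

definition uniformly_distributed :: "'w measure \<Rightarrow> ('w \<Rightarrow> real) \<Rightarrow> real \<Rightarrow> real \<Rightarrow> bool" where
  "uniformly_distributed M X a b \<longleftrightarrow>
     distributed M lborel X (\<lambda>x. ennreal (indicator {a..b} x / measure lborel {a..b}))"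

text \<open>In what follows \<open>X i K\<close> is the random variable modelling the \<open>H\<^sup>1(K)\<close> norm of
  the error of Lagrange interpolation of degree \<open>i\<close> on \<open>K\<close>, and \<open>C i\<close> is the constant of the
  bound \<open>C i * diameter K ^ i\<close> on it, the same for all simplexes.  The model prescribes the law
  of these errors directly: for a fixed function and a fixed simplex the norm is a number, so \<open>X\<close>
  is a family of random variables and not that norm itself.  Nonnegativity and the bound hold
  almost surely by the uniform law.\<close>

definition interpolation_error_model ::
    "'w measure \<Rightarrow> (nat \<Rightarrow> real) \<Rightarrow> (nat \<Rightarrow> 'a::euclidean_space set \<Rightarrow> 'w \<Rightarrow> real)
      \<Rightarrow> nat \<Rightarrow> nat \<Rightarrow> 'a set set \<Rightarrow> bool" where
  "interpolation_error_model M C X k m T \<longleftrightarrow>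
     (\<forall>K\<in>T.
        (\<forall>i\<in>{k, m}. uniformly_distributed M (X i K) 0 (C i * diameter K ^ i)) \<and>
        prob_space.indep_var M borel (X k K) borel (X m K))"

definition h_star :: "(nat \<Rightarrow> real) \<Rightarrow> nat \<Rightarrow> nat \<Rightarrow> real" where
  "h_star C k m = (C k / C m) powr (1 / real (m - k))"

definition more_accurate ::
    "(nat \<Rightarrow> 'a set \<Rightarrow> 'w \<Rightarrow> real) \<Rightarrow> nat \<Rightarrow> nat \<Rightarrow> 'a set \<Rightarrow> 'w \<Rightarrow> nat" where
  "more_accurate X k m K \<omega> = (if X m K \<omega> \<le> X k K \<omega> then 1 else 0)"

end

theory Submission
  imports Defs
begin

text \<open>The event \<open>S \<omega> \<ge> 1\<close> fails exactly when every
  \<open>Y \<mu>\<close> vanishes, so by independence its complement has as probability a product of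
  one factor per simplex (\<open>prob_sum_ge_1\<close>). Each factor is the probability that the
  error of degree \<open>k\<close> is strictly below that of degree \<open>m\<close>. On one simplex
  of diameter \<open>d\<close> the pair of errors is uniform on the rectangle with sides
  \<open>a = C k * d ^ k\<close> and \<open>b = C m * d ^ m\<close>, so the factor is a quotient of
  areas (\<open>prob_uniform_less\<close>). If \<open>b \<le> a\<close>, the favourable region is a
  right triangle with legs \<open>b\<close>, which gives \<open>b / (2 * a)\<close>; otherwise its
  complement is a triangle with legs \<open>a\<close>, which gives \<open>1 - a / (2 * b)\<close>.
  Since \<open>b / a\<close> is the power \<open>m - k\<close> of \<open>d / h_star C k m\<close>,
  the critical diameter is the one at which the two ranges coincide, and it decides which formula
  applies (\<open>prob_more_accurate_eq_0\<close>).\<close>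

lemma uniformly_distributed_0_iff:
  assumes "0 < a"
  shows "uniformly_distributed M X 0 a \<longleftrightarrow>
           distributed M lborel X (\<lambda>x. ennreal (1 / a) * indicator {0..a} x)"
proof -
  have "(\<lambda>x. ennreal (indicator {0..a} x / measure lborel {0..a}))
        = (\<lambda>x. ennreal (1 / a) * indicator {0..a} x)"
    using assms by (auto simp: fun_eq_iff split: split_indicator)
  then show ?thesis
    unfolding uniformly_distributed_def by simp
qed

lemma (in prob_space) indep_set_commute: "indep_set A B \<Longrightarrow> indep_set B A"
  unfolding indep_sets2_eq by (metis Int_commute mult.commute)

lemma (in prob_space) indep_var_commute: "indep_var S X T Y \<Longrightarrow> indep_var T Y S X"
  unfolding indep_var_eq by (blast intro: indep_set_commute)

text \<open>The condition on \<open>R\<close> is the form that covers the strict and the weak comparison at once.\<close>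

lemma (in prob_space) prob_compare_uniform:
  fixes U V :: "'a \<Rightarrow> real"
  assumes "0 < a" "0 < b"
    and U: "uniformly_distributed M U 0 a"
    and V: "uniformly_distributed M V 0 b"
    and indep: "indep_var borel U borel V"
    and R[measurable]: "Measurable.pred (borel \<Otimes>\<^sub>M borel) (\<lambda>(x, y). R x y)"
    and slice: "\<And>y. y \<in> {0..b} \<Longrightarrow> emeasure lborel {x \<in> {0..a}. R x y} = ennreal y"
  shows "prob {\<omega> \<in> space M. R (U \<omega>) (V \<omega>)} = b / (2 * a)"
proof -
  let ?f = "\<lambda>x. ennreal (1 / a) * indicator {0..a} x"
  let ?g = "\<lambda>y. ennreal (1 / b) * indicator {0..b} y"
  let ?E = "{(x, y). R x y}"
  have dU: "distributed M lborel U ?f" and dV: "distributed M lborel V ?g"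
    using assms by (simp_all add: uniformly_distributed_0_iff)
  have lborel_lborel: "sets (lborel \<Otimes>\<^sub>M lborel) = sets (borel \<Otimes>\<^sub>M borel :: (real \<times> real) measure)"
    by (rule sets_pair_measure_cong) auto
  have E: "?E \<in> sets (lborel \<Otimes>\<^sub>M lborel)"
    unfolding lborel_lborel using R by (simp add: pred_def space_pair_measure case_prod_unfold)
  \<comment> \<open>Independence depends only on the sigma-algebra, which \<open>borel\<close> and
    \<open>lborel\<close> share.\<close>
  have "indep_var lborel U lborel V"
    using indep unfolding indep_var_eq by simp
  from distributed_joint_indep[OF _ _ dU dV this]
  have joint: "distributed M (lborel \<Otimes>\<^sub>M lborel) (\<lambda>\<omega>. (U \<omega>, V \<omega>)) (\<lambda>(x, y). ?f x * ?g y)"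
    by (simp add: lborel.sigma_finite_measure_axioms)
  have "emeasure M {\<omega> \<in> space M. R (U \<omega>) (V \<omega>)}
      = emeasure M ((\<lambda>\<omega>. (U \<omega>, V \<omega>)) -` ?E \<inter> space M)"
    by (rule arg_cong[where f = "emeasure M"]) auto
  also have "\<dots> = (\<integral>\<^sup>+ z. (case z of (x, y) \<Rightarrow> ?f x * ?g y) * indicator ?E z \<partial>(lborel \<Otimes>\<^sub>M lborel))"
    by (rule distributed_emeasure[OF joint E])
  \<comment> \<open>Tonelli with \<open>x\<close> innermost, so that the inner integral measures the
    slice at height \<open>y\<close>.\<close>
  also have "\<dots> = (\<integral>\<^sup>+ y. \<integral>\<^sup>+ x. ?f x * ?g y * indicator ?E (x, y) \<partial>lborel \<partial>lborel)"
    using E by (subst lborel_pair.nn_integral_snd[symmetric])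
      (auto intro!: borel_measurable_times_ennreal simp: case_prod_unfold)
  also have "\<dots> = (\<integral>\<^sup>+ y. ennreal (1 / (a * b)) * (ennreal y * indicator {0..b} y) \<partial>lborel)"
  proof (rule nn_integral_cong)
    fix y :: real
    have "(\<lambda>x. R x y) \<in> measurable borel (count_space UNIV)"
      by measurable
    then have sec: "{x \<in> {0..a}. R x y} \<in> sets lborel"
      by (simp add: pred_def)
    have "(\<integral>\<^sup>+ x. ?f x * ?g y * indicator ?E (x, y) \<partial>lborel)
        = (\<integral>\<^sup>+ x. ennreal (1 / a) * ?g y * indicator {x \<in> {0..a}. R x y} x \<partial>lborel)"
      by (intro nn_integral_cong) (auto split: split_indicator)
    also have "\<dots> = ennreal (1 / a) * ?g y * emeasure lborel {x \<in> {0..a}. R x y}"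
      using sec by (rule nn_integral_cmult_indicator)
    \<comment> \<open>Outside \<open>{0..b}\<close> the density of \<open>V\<close> makes both sides
      zero, so \<open>slice\<close> is needed only inside.\<close>
    also have "\<dots> = ennreal (1 / (a * b)) * (ennreal y * indicator {0..b} y)"
      using slice[of y] \<open>0 < a\<close> \<open>0 < b\<close>
      by (auto split: split_indicator simp: ennreal_mult'[symmetric])
    finally show "(\<integral>\<^sup>+ x. ?f x * ?g y * indicator ?E (x, y) \<partial>lborel)
        = ennreal (1 / (a * b)) * (ennreal y * indicator {0..b} y)" .
  qed
  also have "\<dots> = ennreal (1 / (a * b)) * (\<integral>\<^sup>+ y. ennreal y * indicator {0..b} y \<partial>lborel)"
    by (rule nn_integral_cmult) simp
  also have "(\<integral>\<^sup>+ y. ennreal y * indicator {0..b} y \<partial>lborel) = ennreal (b\<^sup>2 / 2 - 0\<^sup>2 / 2)"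
    using \<open>0 < b\<close> by (intro nn_integral_FTC_Icc) (auto intro!: derivative_eq_intros)
  also have "ennreal (1 / (a * b)) * \<dots> = ennreal (b / (2 * a))"
    using \<open>0 < a\<close> \<open>0 < b\<close>
    by (simp add: ennreal_mult'[symmetric] power2_eq_square field_simps)
  finally show ?thesis
    using \<open>0 < a\<close> \<open>0 < b\<close> by (simp add: measure_def)
qed

text \<open>The variable with the shorter range has to be the one that is held fixed: only then does
  the slice below each of its values \<open>y\<close> have full length \<open>y\<close>. If
  \<open>U\<close> has the shorter range, the roles are exchanged and the complement is taken, which
  turns the strict comparison into a weak one.\<close>

lemma (in prob_space) prob_uniform_less:
  fixes U V :: "'a \<Rightarrow> real"
  assumes "0 < a" "0 < b"
    and U: "uniformly_distributed M U 0 a"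
    and V: "uniformly_distributed M V 0 b"
    and indep: "indep_var borel U borel V"
  shows "prob {\<omega> \<in> space M. U \<omega> < V \<omega>} = (if b \<le> a then b / (2 * a) else 1 - a / (2 * b))"
proof (cases "b \<le> a")
  case True
  have "prob {\<omega> \<in> space M. U \<omega> < V \<omega>} = b / (2 * a)"
  proof (rule prob_compare_uniform[OF \<open>0 < a\<close> \<open>0 < b\<close> U V indep])
    fix y assume y: "y \<in> {0..b}"
    then have "{x \<in> {0..a}. x < y} = {0..<y}"
      using True by auto
    then show "emeasure lborel {x \<in> {0..a}. x < y} = ennreal y"
      using y by simp
  qed simp
  then show ?thesis
    using True by simp
next
  case False
  have [measurable]: "random_variable borel U" "random_variable borel V"
    using indep unfolding indep_var_eq by auto
  have "indep_var borel V borel U"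
    using indep by (rule indep_var_commute)
  have "prob {\<omega> \<in> space M. V \<omega> \<le> U \<omega>} = a / (2 * b)"
  proof (rule prob_compare_uniform[OF \<open>0 < b\<close> \<open>0 < a\<close> V U \<open>indep_var borel V borel U\<close>])
    fix y assume y: "y \<in> {0..a}"
    then have "{x \<in> {0..b}. x \<le> y} = {0..y}"
      using False by auto
    then show "emeasure lborel {x \<in> {0..b}. x \<le> y} = ennreal y"
      using y by simp
  qed simp
  moreover have "prob {\<omega> \<in> space M. \<not> V \<omega> \<le> U \<omega>} = 1 - prob {\<omega> \<in> space M. V \<omega> \<le> U \<omega>}"
    by (rule prob_neg) measurable
  ultimately show ?thesis
    using False by (simp add: not_le)
qed

lemma h_star_power:
  assumes "k < m" "0 < C k" "0 < C m"
  shows "h_star C k m ^ (m - k) = C k / C m"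
  using assms by (simp add: h_star_def powr_power)

lemma h_star_pos:
  assumes "0 < C k" "0 < C m"
  shows "0 < h_star C k m"
  using assms by (simp add: h_star_def)

lemma (in prob_space) prob_more_accurate_eq_0:
  assumes "k < m" "0 < C k" "0 < C m" "0 < diameter K"
    and model: "interpolation_error_model M C X k m T" "K \<in> T"
  defines "q \<equiv> diameter K / h_star C k m"
  shows "prob {\<omega> \<in> space M. more_accurate X k m K \<omega> = 0}
           = (if diameter K \<le> h_star C k m then 1 / 2 * q ^ (m - k)
              else 1 - 1 / 2 * (1 / q) ^ (m - k))"
proof -
  let ?a = "C k * diameter K ^ k" and ?b = "C m * diameter K ^ m"
  have pos: "0 < ?a" "0 < ?b"
    using assms by simp_all
  \<comment> \<open>The power removes the root in \<open>h_star\<close>, and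
    \<open>diameter K ^ (m - k)\<close> is the quotient of the two powers of the diameter.\<close>
  have ratio: "q ^ (m - k) = ?b / ?a"
    using assms(1-4) unfolding q_def
    by (simp add: power_divide h_star_power power_diff mult.commute)
  have q: "0 < q"
    using assms(2-4) by (simp add: q_def h_star_pos)
  have "diameter K \<le> h_star C k m \<longleftrightarrow> q \<le> 1"
    using assms(2,3) h_star_pos[of C k m] by (simp add: q_def)
  \<comment> \<open>This needs a positive exponent, hence \<open>k < m\<close>.\<close>
  also have "\<dots> \<longleftrightarrow> q ^ (m - k) \<le> 1"
    using q \<open>k < m\<close> by (simp add: power_le_one_iff)
  also have "\<dots> \<longleftrightarrow> ?b \<le> ?a"
    using pos by (simp add: ratio)
  finally have iff: "diameter K \<le> h_star C k m \<longleftrightarrow> ?b \<le> ?a" .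
  have "prob {\<omega> \<in> space M. X k K \<omega> < X m K \<omega>}
      = (if ?b \<le> ?a then ?b / (2 * ?a) else 1 - ?a / (2 * ?b))"
    using model pos unfolding interpolation_error_model_def
    by (intro prob_uniform_less) auto
  also have "{\<omega> \<in> space M. X k K \<omega> < X m K \<omega>} = {\<omega> \<in> space M. more_accurate X k m K \<omega> = 0}"
    by (auto simp: more_accurate_def)
  finally show ?thesis
    unfolding iff power_one_over ratio by simp
qed

lemma (in prob_space) prob_sum_ge_1:
  fixes Y :: "'i \<Rightarrow> 'a \<Rightarrow> nat"
  assumes "finite I" and indep: "indep_vars (\<lambda>_. count_space UNIV) Y I"
  shows "prob {\<omega> \<in> space M. 1 \<le> (\<Sum>i\<in>I. Y i \<omega>)}
           = 1 - (\<Prod>i\<in>I. prob {\<omega> \<in> space M. Y i \<omega> = 0})"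
\<comment> \<open>The product rule \<open>indep_varsD\<close> asks for a nonempty index set. For an
  empty one the event is empty and the right-hand side is \<open>1 - 1\<close>.\<close>
proof (cases "I = {}")
  case False
  have [measurable]: "Y i \<in> measurable M (count_space UNIV)" if "i \<in> I" for i
    using indep that by (simp add: indep_vars_def)
  have ev: "{\<omega> \<in> space M. \<forall>i\<in>I. Y i \<omega> = 0} \<in> events"
    using \<open>finite I\<close> by measurable
  \<comment> \<open>A finite sum of natural numbers vanishes only if all its terms do.\<close>
  have "{\<omega> \<in> space M. 1 \<le> (\<Sum>i\<in>I. Y i \<omega>)} = {\<omega> \<in> space M. \<not> (\<forall>i\<in>I. Y i \<omega> = 0)}"
    using \<open>finite I\<close> by (auto simp: Suc_le_eq simp flip: neq0_conv)
  also have "prob \<dots> = 1 - prob {\<omega> \<in> space M. \<forall>i\<in>I. Y i \<omega> = 0}"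
    using ev by (rule prob_neg)
  also have "{\<omega> \<in> space M. \<forall>i\<in>I. Y i \<omega> = 0} = (\<Inter>i\<in>I. Y i -` {0} \<inter> space M)"
    using False by auto
  also have "prob \<dots> = (\<Prod>i\<in>I. prob (Y i -` {0} \<inter> space M))"
    by (rule indep_varsD[OF indep False \<open>finite I\<close>]) auto
  also have "\<dots> = (\<Prod>i\<in>I. prob {\<omega> \<in> space M. Y i \<omega> = 0})"
    by (intro prod.cong arg_cong[where f = prob]) auto
  finally show ?thesis .
qed simp

theorem proposition4p3:
  fixes M :: "'w measure"
    and \<Omega> :: "'a::euclidean_space set"
    and T :: "'a set set"
    and K :: "nat \<Rightarrow> 'a set"
    and h :: "nat \<Rightarrow> real"
    and C :: "nat \<Rightarrow> real"
    and X :: "nat \<Rightarrow> 'a set \<Rightarrow> 'w \<Rightarrow> real"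
    and Y :: "nat \<Rightarrow> 'w \<Rightarrow> nat"
    and S :: "'w \<Rightarrow> nat"
    and k m N N1 N2 :: nat
    and hs :: real
  assumes "prob_space M"
    and "0 < k" and "k < m"
    and "open \<Omega>" and "bounded \<Omega>"
    and "simplicial_mesh \<Omega> T"
    and "bij_betw K {1..N} T"
    and h_def: "\<And>\<mu>. \<mu> \<in> {1..N} \<Longrightarrow> h \<mu> = diameter (K \<mu>)"
    and "\<And>\<mu>. \<mu> \<in> {1..N} \<Longrightarrow> 0 < h \<mu>"
    and "0 < C k" and "0 < C m"
    and "interpolation_error_model M C X k m T"
    and hs_def: "hs = h_star C k m"
    and "N = N1 + N2"
    and "\<And>\<mu>. \<mu> \<in> {1..N1} \<Longrightarrow> h \<mu> \<le> hs"
    and "\<And>\<mu>. \<mu> \<in> {N1+1..N} \<Longrightarrow> hs < h \<mu>"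
    and Y_def: "\<And>\<mu>. \<mu> \<in> {1..N} \<Longrightarrow> Y \<mu> = more_accurate X k m (K \<mu>)"
    and "prob_space.indep_vars M (\<lambda>_. count_space UNIV) Y {1..N}"
    and S_def: "\<And>\<omega>. S \<omega> = (\<Sum>\<mu>=1..N. Y \<mu> \<omega>)"
  shows "measure M {\<omega> \<in> space M. S \<omega> \<ge> 1} =
           1 - 1 / 2 ^ N1 * ((\<Prod>\<mu>=1..N1. h \<mu>) / hs ^ N1) ^ (m - k)
                 * (\<Prod>\<mu>=N1+1..N. 1 - 1 / 2 * (hs / h \<mu>) ^ (m - k))"
proof -
  interpret prob_space M by fact
  let ?p = "\<lambda>\<mu>. prob {\<omega> \<in> space M. Y \<mu> \<omega> = 0}"
  have p: "?p \<mu> = (if h \<mu> \<le> hs then 1 / 2 * (h \<mu> / hs) ^ (m - k)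
                       else 1 - 1 / 2 * (hs / h \<mu>) ^ (m - k))" if "\<mu> \<in> {1..N}" for \<mu>
  proof -
    have "K \<mu> \<in> T"
      using \<open>bij_betw K {1..N} T\<close> that by (rule bij_betwE[THEN bspec])
    moreover have "0 < diameter (K \<mu>)"
      using assms(9)[OF that] h_def[OF that] by simp
    ultimately show ?thesis
      using prob_more_accurate_eq_0[of k m C "K \<mu>" X T] \<open>k < m\<close> \<open>0 < C k\<close> \<open>0 < C m\<close>
        \<open>interpolation_error_model M C X k m T\<close> h_def[OF that] Y_def[OF that]
      by (simp add: hs_def)
  qed
  have "prob {\<omega> \<in> space M. S \<omega> \<ge> 1} = 1 - (\<Prod>\<mu>=1..N. ?p \<mu>)"
    unfolding S_def by (rule prob_sum_ge_1) (use assms in auto)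
  \<comment> \<open>The split also holds when \<open>N1\<close> or \<open>N2\<close> is
    \<open>0\<close>, one factor then being an empty product. The ordering of the simplexes makes
    \<open>p\<close> take a single branch on each part.\<close>
  also have "(\<Prod>\<mu>=1..N. ?p \<mu>) = (\<Prod>\<mu>=1..N1. ?p \<mu>) * (\<Prod>\<mu>=N1+1..N. ?p \<mu>)"
    unfolding \<open>N = N1 + N2\<close> by (rule prod.ub_add_nat) simp
  also have "(\<Prod>\<mu>=1..N1. ?p \<mu>) = (\<Prod>\<mu>=1..N1. 1 / 2 * (h \<mu> / hs) ^ (m - k))"
    using assms(15) \<open>N = N1 + N2\<close> by (intro prod.cong) (auto simp: p)
  also have "\<dots> = 1 / 2 ^ N1 * ((\<Prod>\<mu>=1..N1. h \<mu>) / hs ^ N1) ^ (m - k)"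
    by (simp add: prod.distrib prod_dividef power_one_over flip: prod_power_distrib)
  also have "(\<Prod>\<mu>=N1+1..N. ?p \<mu>) = (\<Prod>\<mu>=N1+1..N. 1 - 1 / 2 * (hs / h \<mu>) ^ (m - k))"
    using assms(16) by (intro prod.cong) (auto simp: p not_le[symmetric])
  finally show ?thesis
    by simp
qed

end
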